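(* Let $0<\alpha<1$, $J\in\{1,2\}$, and let $\mathcal N_\tau\ge 2$ and $K\ge 0$ be integers. There is a constant $C$, independent of $h$ and $\epsilon_K$ (and of $n$ and $u$), such that for every time step $2\le n\le N_T$ and every $u\in C^{J+1}[0,t_n]$, the gap between the Caputo fractional derivative and the numerical Caputo fractional derivative produced by the FAOM-P$K$ method satisfies $$\Big|\,{}^C_0\mathcal D^{\alpha}_t u(t_n)-{}^C_0\mathcal D^{F,\alpha}_t u(t_n)\Big|\le |\mathcal R_{J,h}|+C\,\epsilon_K\,t_n^{1-\alpha}\max_{0\le t\le t_n}|u'(t)| .$$
   Context: Grid: $T>0$, $N_T\in\mathbb N$, $h=T/N_T$, $t_n=nh$ for $n=0,\dots,N_T$, $t_{j-1/2}=(t_{j-1}+t_j)/2$, $u^n=u(t_n)$. Caputo derivative: ${}^C_0\mathcal D^\alpha_t u(t)=\frac{1}{\Gamma(1-\alpha)}\int_0^t\frac{u'(\tau)}{(t-\tau)^\alpha}\,d\tau$. Interpolants: $\Pi_{1,h}u$ is the continuous piecewise linear interpolant of $u$ at the grid points. $\Pi_{2,h}u$ equals, on $[t_{j-1},t_j]$ with $j\ge2$, the quadratic polynomial interpolating $u$ at $t_{j-2},t_{j-1},t_j$; and $\Pi_{2,h}u=\Pi_{1,h}u$ on $[t_0,t_1]$. Subintervals at time step $n$: fix an integer $\mathcal N_\tau\ge2$. Finite decreasing lists $\mathbf I^n=[I^n_1,\dots,I^n_{\mathcal M_n}]$ (the left endpoints of subintervals) are defined recursively; $\mathbf I^1$ is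 the empty list. For $n=2,3,\dots,N_T$: (1) let $\tilde{\mathbf I}^n$ be obtained by prepending $t_{n-2}$ to $\mathbf I^{n-1}$, and set $\tilde I^n_0=t_{n-1}$. (2) As long as there is an index $i_0\ge0$ for which the $2\mathcal N_\tau-1$ consecutive gaps $\tilde I^n_{i_0}-\tilde I^n_{i_0+1}=\cdots=\tilde I^n_{i_0+2\mathcal N_\tau-2}-\tilde I^n_{i_0+2\mathcal N_\tau-1}$ are all equal, delete the entries with indices $i_0+\mathcal N_\tau,\dots,i_0+2\mathcal N_\tau-2$ from the list (i.e. merge the $\mathcal N_\tau$ leftmost of these subintervals into one) and re-index. (3) The final list is $\mathbf I^n$, with length $\mathcal M_n$, and $I^n_0=t_{n-1}$. Write $I_i=I^n_i$ and $I_{i+\frac12}=(I_i+I_{i+1})/2$. The subintervals $[I_{i+1},I_i]$, $0\le i\le\mathcal M_n-1$, cover $[0,t_{n-1}]$. Kernel approximation: $w_0,\dots,w_K$ are real numbers and $\epsilon_K\geq 0$ is such that $\big|\frac{1}{(1-\tau)^\alpha}-\sum_{k=0}^K w_k\tau^k\big|\le\epsilon_K$ for all $\tau\in[-\frac13,\frac13]$. Numerical Caputo derivative (FAOM-P$K$): $${}^C_0\mathcal D^{F,\alpha}_t u(t_n)=\frac{1}{\Gamma(1-\alpha)}\int_{t_{n-1}}^{t_n}\frac{(\Pi_{J,h}u(\tau))'}{(t_n-\tau)^\alpha}d\tau+\sum_{i=0}^{\mathcal M_n-1}\sum_{k=0}^K\frac{\bar w^i_k}{\Gamma(1-\alpha)}\int_{I_{i+1}}^{I_i}(\Pi_{J,h}u(\tau))'\Big(\frac{\tau-I_{i+\frac12}}{I_i-I_{i+\frac12}}\Big)^k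 d\tau,$$ with $\bar w^i_k=w_k\frac{(I_i-I_{i+\frac12})^k}{(t_n-I_{i+\frac12})^{k+\alpha}}$. Truncation error of the direct method: $\mathcal R_{J,h}={}^C_0\mathcal D^\alpha_t u(t_n)-\frac{1}{\Gamma(1-\alpha)}\int_0^{t_n}\frac{(\Pi_{J,h}u(\tau))'}{(t_n-\tau)^\alpha}d\tau$. *)

theory Defs
  imports "HOL-Analysis.Analysis"
begin

definition grid :: "real \<Rightarrow> nat \<Rightarrow> real" where
  "grid h n = real n * h"

text \<open>Derivatives are taken within the set, hence one-sided at the endpoints of an
  interval: only the values of the function on the set matter.\<close>

definition Ck_on :: "nat \<Rightarrow> (real \<Rightarrow> real) \<Rightarrow> real set \<Rightarrow> bool" where
  "Ck_on m f S \<longleftrightarrow>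
    (\<exists>D :: nat \<Rightarrow> real \<Rightarrow> real.
       (\<forall>t\<in>S. D 0 t = f t) \<and>
       (\<forall>k<m. \<forall>t\<in>S. (D k has_real_derivative D (Suc k) t) (at t within S)) \<and>
       continuous_on S (D m))"

definition caputo :: "real \<Rightarrow> (real \<Rightarrow> real) \<Rightarrow> real \<Rightarrow> real" where
  "caputo \<alpha> u t =
    1 / Gamma (1 - \<alpha>) *
    integral {0..t} (\<lambda>\<tau>. vector_derivative u (at \<tau> within {0..t}) / (t - \<tau>) powr \<alpha>)"

text \<open>The polynomial of degree less than \<open>card S\<close> that agrees with \<open>u\<close> on the finite
  set \<open>S\<close> (Lagrange form).\<close>

definition lagrange :: "real set \<Rightarrow> (real \<Rightarrow> real) \<Rightarrow> real \<Rightarrow> real" where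
  "lagrange S u x = (\<Sum>a\<in>S. u a * (\<Prod>b\<in>S - {a}. (x - b) / (a - b)))"

text \<open>For \<open>\<tau> > 0\<close> this is the \<open>j\<close> with \<open>grid h (j - 1) < \<tau> \<le> grid h j\<close>; it is \<open>1\<close> for \<open>\<tau> = 0\<close>.\<close>

definition cell :: "real \<Rightarrow> real \<Rightarrow> nat" where
  "cell h \<tau> = max 1 (nat \<lceil>\<tau> / h\<rceil>)"

definition interp1 :: "real \<Rightarrow> (real \<Rightarrow> real) \<Rightarrow> real \<Rightarrow> real" where
  "interp1 h u \<tau> =
    (let j = cell h \<tau> in lagrange {grid h (j - 1), grid h j} u \<tau>)"

definition interp2 :: "real \<Rightarrow> (real \<Rightarrow> real) \<Rightarrow> real \<Rightarrow> real" where
  "interp2 h u \<tau> =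
    (let j = cell h \<tau> in
     if j \<ge> 2 then lagrange {grid h (j - 2), grid h (j - 1), grid h j} u \<tau>
     else interp1 h u \<tau>)"

text \<open>Only used for \<open>J = 1\<close> and \<open>J = 2\<close>. Below, \<open>deriv (interp J h u)\<close> may be unspecified at
  the grid points; it is only integrated, and these points form a null set.\<close>

definition interp :: "nat \<Rightarrow> real \<Rightarrow> (real \<Rightarrow> real) \<Rightarrow> real \<Rightarrow> real" where
  "interp J = (if J = 1 then interp1 else interp2)"

definition trunc_error :: "nat \<Rightarrow> real \<Rightarrow> real \<Rightarrow> (real \<Rightarrow> real) \<Rightarrow> nat \<Rightarrow> real" where
  "trunc_error J h \<alpha> u n =
    caputo \<alpha> u (grid h n) -
    1 / Gamma (1 - \<alpha>) *
    integral {0..grid h n} (\<lambda>\<tau>. deriv (interp J h u) \<tau> / (grid h n - \<tau>) powr \<alpha>)"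

text \<open>One merge. Here \<open>L\<close> includes the entry of index \<open>0\<close>. The entries with indices
  \<open>i\<^sub>0 + N, \<dots>, i\<^sub>0 + 2 N - 2\<close> are deleted.\<close>

definition merge_step :: "nat \<Rightarrow> real list \<Rightarrow> real list \<Rightarrow> bool" where
  "merge_step N L L' \<longleftrightarrow>
    (\<exists>i\<^sub>0. i\<^sub>0 + 2 * N - 1 < length L \<and>
      (\<forall>k \<le> 2 * N - 2.
         L ! (i\<^sub>0 + k) - L ! (i\<^sub>0 + k + 1) = L ! i\<^sub>0 - L ! (i\<^sub>0 + 1)) \<and>
      L' = take (i\<^sub>0 + N) L @ drop (i\<^sub>0 + 2 * N - 1) L)"

text \<open>\<open>subdivision h N n I\<close>: the list \<open>I = [I\<^sub>1, \<dots>, I\<^sub>M]\<close> is a possible outcome of the merging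
  procedure at time step \<open>n\<close>; the entry \<open>I\<^sub>0 = grid h (n - 1)\<close> is not stored in \<open>I\<close>. A relation
  rather than a function, since the procedure does not prescribe which of several mergeable
  blocks is merged first.\<close>

inductive subdivision :: "real \<Rightarrow> nat \<Rightarrow> nat \<Rightarrow> real list \<Rightarrow> bool"
  for h :: real and N :: nat where
  start: "subdivision h N 1 []"
| step: "subdivision h N (Suc n) I'"
    if "subdivision h N n I"
      and "(merge_step N)\<^sup>*\<^sup>* (grid h n # grid h (n - 1) # I) (grid h n # I')"
      and "\<not> (\<exists>L. merge_step N (grid h n # I') L)"

definition faom_weight ::
    "(nat \<Rightarrow> real) \<Rightarrow> real \<Rightarrow> real \<Rightarrow> real \<Rightarrow> real \<Rightarrow> nat \<Rightarrow> real" where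
  "faom_weight w \<alpha> t a b k =
    w k * (b - (a + b) / 2) ^ k / (t - (a + b) / 2) powr (real k + \<alpha>)"

definition caputo_faom ::
    "nat \<Rightarrow> real \<Rightarrow> nat \<Rightarrow> (nat \<Rightarrow> real) \<Rightarrow> real list \<Rightarrow> real \<Rightarrow> (real \<Rightarrow> real) \<Rightarrow> nat \<Rightarrow> real" where
  "caputo_faom J h K w I \<alpha> u n =
    (let t = grid h n; P = grid h (n - 1) # I in
     1 / Gamma (1 - \<alpha>) *
       integral {grid h (n - 1)..t} (\<lambda>\<tau>. deriv (interp J h u) \<tau> / (t - \<tau>) powr \<alpha>) +
     (\<Sum>i<length I. \<Sum>k\<le>K.
        (let a = P ! Suc i; b = P ! i; m = (a + b) / 2 in
         faom_weight w \<alpha> t a b k / Gamma (1 - \<alpha>) *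
           integral {a..b} (\<lambda>\<tau>. deriv (interp J h u) \<tau> * ((\<tau> - m) / (b - m)) ^ k))))"

lemma merge_step_cases_head:
  assumes "merge_step N (x # I) L" "N \<ge> 2"
  obtains I' where "L = x # I'" "length I' < length I"
proof -
  obtain i where i: "i + 2 * N - 1 < length (x # I)"
      "L = take (i + N) (x # I) @ drop (i + 2 * N - 1) (x # I)"
    using assms(1) unfolding merge_step_def by blast
  define I' where "I' = take (i + N - 1) I @ drop (i + 2 * N - 2) I"
  have "L = x # I'"
    using i(2) assms(2) by (auto simp: I'_def take_Cons' drop_Cons' numeral_2_eq_2)
  moreover have "length I' < length I"
    using i(1) assms(2) by (auto simp: I'_def)
  ultimately show ?thesis by (rule that)
qed

text \<open>The merging procedure always has an outcome.\<close>

lemma merge_terminates: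
  assumes "N \<ge> 2"
  shows "\<exists>I'. (merge_step N)\<^sup>*\<^sup>* (x # I) (x # I') \<and> \<not> (\<exists>L. merge_step N (x # I') L)"
proof (induction "length I" arbitrary: I rule: less_induct)
  case less
  show ?case
  proof (cases "\<exists>L. merge_step N (x # I) L")
    case True
    then obtain I1 where "merge_step N (x # I) (x # I1)" "length I1 < length I"
      using merge_step_cases_head[OF _ assms] by metis
    with less[of I1] show ?thesis
      by (meson converse_rtranclp_into_rtranclp)
  qed blast
qed

lemma subdivision_exists:
  assumes "N \<ge> 2" "n \<ge> 1"
  shows "\<exists>I. subdivision h N n I"
  using assms(2)
proof (induction n rule: dec_induct)
  case base
  show ?case using subdivision.start by blast
next
  case (step n)
  then show ?case
    using merge_terminates[OF assms(1)] subdivision.step by metis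
qed

end

theory Submission imports Defs begin

text \<open>Both methods differentiate the same interpolant and treat the last cell
  \<open>[t\<^sub>n\<^sub>-\<^sub>1, t\<^sub>n]\<close> in the same way. Hence the gap equals the truncation error of the direct
  method plus \<open>1 / \<Gamma>(1 - \<alpha>)\<close> times the error made on \<open>[0, t\<^sub>n\<^sub>-\<^sub>1]\<close> by replacing the kernel
  \<open>(t\<^sub>n - \<tau>)\<^bsup>-\<alpha>\<^esup>\<close> by its local expansions, and only the latter has to be estimated.

  On a subinterval \<open>[a, b]\<close> with midpoint \<open>m\<close>, put \<open>\<sigma> = (\<tau> - m) / (t\<^sub>n - m)\<close>. The kernel is then
  \<open>(t\<^sub>n - m)\<^bsup>-\<alpha>\<^esup> (1 - \<sigma>)\<^bsup>-\<alpha>\<^esup>\<close>, and the weights are chosen so that the expansion is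
  \<open>(t\<^sub>n - m)\<^bsup>-\<alpha>\<^esup> \<Sum>\<^sub>k w\<^sub>k \<sigma>\<^sup>k\<close>. So the hypothesis on \<open>w\<close> applies as soon as \<open>\<bar>\<sigma>\<bar> \<le> 1/3\<close>, which
  means that the subinterval is no longer than its distance to \<open>t\<^sub>n\<close>: \<open>b - a \<le> t\<^sub>n - b\<close>. This is
  an invariant of the merging procedure (\<open>subdivision_admissible\<close>): the \<open>N\<close> leftmost of
  \<open>2 N - 1\<close> subintervals of equal length \<open>d\<close> are merged, so the other \<open>N - 1\<close> of them, and a
  distance of at least \<open>d\<close> to their right, separate the merged one from \<open>t\<^sub>n\<close>.

  Since \<open>1 - \<sigma> \<le> 4/3\<close>, the pointwise error is at most \<open>(4/3)\<^bsup>\<alpha>\<^esup> \<epsilon> (t\<^sub>n - \<tau>)\<^bsup>-\<alpha>\<^esup>\<close>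
  (\<open>local_expansion_error\<close>). This bound is a multiple of the kernel itself, whose integral over
  all subintervals together is at most \<open>t\<^sub>n\<^bsup>1-\<alpha>\<^esup> / (1 - \<alpha>)\<close>, however many there are
  (\<open>composite_quadrature_error\<close>). Finally the derivative of the interpolant is at most
  twice the maximum of \<open>\<bar>u'\<bar>\<close> (\<open>interp_slope_bound\<close> with \<open>slope_bound\<close>), which gives the theorem with
  \<open>C = 2 (4/3)\<^bsup>\<alpha>\<^esup> / ((1 - \<alpha>) \<Gamma>(1 - \<alpha>))\<close>.\<close>

section \<open>Geometry of the merged subintervals\<close>

text \<open>The list holds the endpoints of the subintervals from right to left, the right endpoint
  \<open>I\<^sub>0\<close> included. The last inequality says that a subinterval is at most as long as its distance
  to \<open>t\<close>; relative to its midpoint \<open>m\<close>, all its points then satisfy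
  \<open>\<bar>\<tau> - m\<bar> \<le> (t - m) / 3\<close>.\<close>

definition admissible :: "real \<Rightarrow> real list \<Rightarrow> bool" where
  "admissible t L \<longleftrightarrow> L \<noteq> [] \<and> last L = 0 \<and>
    (\<forall>i. Suc i < length L \<longrightarrow> L ! Suc i < L ! i \<and> L ! i - L ! Suc i \<le> t - L ! i)"

lemma admissible_nth_bounds:
  assumes "admissible t L" "i < length L"
  shows "0 \<le> L ! i" "L ! i \<le> hd L"
proof -
  have dec: "L ! Suc k < L ! k" if "Suc k < length L" for k
    using assms(1) that unfolding admissible_def by auto
  have anti: "L ! j \<le> L ! i" if "i \<le> j" "j < length L" for i j
    using that
  proof (induction rule: dec_induct)
    case (step k)
    then show ?case using dec[of k] by simp
  qed simp
  have ne: "L \<noteq> []" and last: "last L = 0" using assms(1) unfolding admissible_def by auto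
  show "L ! i \<le> hd L" using anti[of 0 i] assms(2) ne by (simp add: hd_conv_nth)
  have "last L \<le> L ! i" using anti[of i "length L - 1"] assms(2) ne by (simp add: last_conv_nth)
  then show "0 \<le> L ! i" using last by simp
qed

text \<open>The passage to the next time step: advancing \<open>t\<close> only increases the distances, so only
  the new subinterval has to be checked.\<close>

lemma admissible_Cons:
  assumes "admissible t (x # L)" "x < y" "y - x \<le> t' - y" "t \<le> t'"
  shows "admissible t' (y # x # L)"
  unfolding admissible_def
proof (intro conjI allI impI)
  show "last (y # x # L) = 0" using assms(1) by (simp add: admissible_def)
next
  fix i assume i: "Suc i < length (y # x # L)"
  show "(y # x # L) ! Suc i < (y # x # L) ! i"
    using assms(1,2) i by (cases i) (auto simp: admissible_def)
  show "(y # x # L) ! i - (y # x # L) ! Suc i \<le> t' - (y # x # L) ! i"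
  proof (cases i)
    case (Suc k)
    then have "(x # L) ! k - (x # L) ! Suc k \<le> t - (x # L) ! k"
      using assms(1) i unfolding admissible_def by simp
    then show ?thesis using Suc assms(4) by simp
  qed (use assms(3) in simp)
qed simp

text \<open>The only new subinterval has length \<open>N d\<close>, where \<open>d\<close> is the common length of the
  \<open>2 N - 1\<close> subintervals of the block. The rightmost of these lies at distance at least \<open>d\<close>
  from \<open>t\<close>, and \<open>N - 1\<close> of them stay to the right of the new one, whose distance to \<open>t\<close> is
  therefore at least \<open>d + (N - 1) d\<close>.\<close>

lemma admissible_merge_step:
  assumes L: "admissible t L" and merge: "merge_step N L L'" and N: "N \<ge> 2"
  shows "admissible t L'"
proof -
  obtain i where len: "i + 2 * N - 1 < length L"
    and eq: "\<And>k. k \<le> 2 * N - 2 \<Longrightarrow> L ! (i + k) - L ! (i + k + 1) = L ! i - L ! (i + 1)"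
    and L': "L' = take (i + N) L @ drop (i + 2 * N - 1) L"
    using merge unfolding merge_step_def by blast
  define d where "d = L ! i - L ! (i + 1)"
  have dec: "L ! Suc k < L ! k" and gap: "L ! k - L ! Suc k \<le> t - L ! k"
    if "Suc k < length L" for k
    using L that unfolding admissible_def by auto
  have arith: "L ! (i + k) = L ! i - real k * d" if "k \<le> 2 * N - 1" for k
    using that
  proof (induction k)
    case (Suc k)
    then have "L ! (i + k) - L ! (i + Suc k) = d" using eq[of k] by (simp add: d_def)
    with Suc show ?case by (simp add: algebra_simps)
  qed simp
  have d: "d > 0" "d \<le> t - L ! i"
    using dec[of i] gap[of i] len N by (auto simp: d_def)
  have nth1: "L' ! k = L ! k" if "k < i + N" for k
    using that len by (simp add: L' nth_append)
  have nth2: "L' ! k = L ! (k + N - 1)" if "k \<ge> i + N" "k < length L'" for k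
  proof -
    have "i + 2 * N - 1 + (k - (i + N)) = k + N - 1" using that N by simp
    then show ?thesis using that len N by (simp add: L' nth_append min_def)
  qed
  have lenL': "length L' = length L - (N - 1)"
    using len N by (simp add: L')
  show ?thesis unfolding admissible_def
  proof (intro conjI allI impI)
    show "L' \<noteq> []" using len by (simp add: L')
    show "last L' = 0" using len L by (simp add: L' admissible_def)
  next
    fix k assume k: "Suc k < length L'"
    consider "Suc k < i + N" | "Suc k = i + N" | "k \<ge> i + N" by linarith
    then have "L' ! Suc k < L' ! k \<and> L' ! k - L' ! Suc k \<le> t - L' ! k"
    proof cases
      case 1
      then have "L' ! Suc k = L ! Suc k" "L' ! k = L ! k"
        by (auto intro: nth1)
      moreover have "Suc k < length L" using k lenL' by simp
      ultimately show ?thesis using dec gap by metis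
    next
      case 2
      have "L' ! k = L ! i - real (N - 1) * d"
      proof -
        have "k = i + (N - 1)" using 2 N by linarith
        then show ?thesis using nth1[of k] arith[of "N - 1"] N by simp
      qed
      moreover have "L' ! Suc k = L ! i - real (2 * N - 1) * d"
      proof -
        have "Suc k + N - 1 = i + (2 * N - 1)" using 2 N by linarith
        then show ?thesis using nth2[of "Suc k"] arith[of "2 * N - 1"] 2 k by simp
      qed
      moreover have "real (2 * N - 1) = 2 * real N - 1" "real (N - 1) = real N - 1"
        using N by (simp_all add: of_nat_diff)
      ultimately have "L' ! k = L ! i - (real N - 1) * d" "L' ! Suc k = L ! i - (2 * real N - 1) * d"
        by simp_all
      moreover have "real N * d > 0" using d N by simp
      ultimately show ?thesis using d(2) by (simp add: algebra_simps)
    next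
      case 3
      have "L' ! Suc k = L ! Suc (k + N - 1)" "L' ! k = L ! (k + N - 1)"
      proof -
        have "Suc k + N - 1 = Suc (k + N - 1)" using N by linarith
        then show "L' ! Suc k = L ! Suc (k + N - 1)" "L' ! k = L ! (k + N - 1)"
          using nth2[of "Suc k"] nth2[of k] 3 k by simp_all
      qed
      moreover have "Suc (k + N - 1) < length L" using k lenL' N by simp
      ultimately show ?thesis using dec gap by metis
    qed
    then show "L' ! Suc k < L' ! k" "L' ! k - L' ! Suc k \<le> t - L' ! k" by auto
  qed
qed

lemma subdivision_admissible:
  assumes "subdivision h N n I" "h > 0" "N \<ge> 2"
  shows "n \<ge> 1 \<and> admissible (grid h n) (grid h (n - 1) # I)"
  using assms(1)
proof induction
  case start
  show ?case by (simp add: admissible_def grid_def)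
next
  case (step n I I')
  have "admissible (grid h (Suc n)) (grid h n # grid h (n - 1) # I)"
    using step.IH assms(2)
    by (intro admissible_Cons[of "grid h n"]) (auto simp: grid_def of_nat_diff algebra_simps)
  with step.hyps(2) have "admissible (grid h (Suc n)) (grid h n # I')"
    by (induction rule: rtranclp_induct) (auto intro: admissible_merge_step assms(3))
  then show ?case by simp
qed

section \<open>The weakly singular kernel and its local expansion\<close>

text \<open>The case \<open>b = t\<close> is included: the antiderivative stays continuous at the singularity
  because \<open>\<alpha> < 1\<close>.\<close>

lemma kernel_has_integral:
  fixes \<alpha> t a b :: real
  assumes "\<alpha> < 1" "a \<le> b" "b \<le> t"
  shows "((\<lambda>\<tau>. 1 / (t - \<tau>) powr \<alpha>) has_integral
    ((t - a) powr (1 - \<alpha>) - (t - b) powr (1 - \<alpha>)) / (1 - \<alpha>)) {a..b}"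
proof -
  define F where "F = (\<lambda>x. - ((t - x) powr (1 - \<alpha>) / (1 - \<alpha>)))"
  have "((\<lambda>\<tau>. 1 / (t - \<tau>) powr \<alpha>) has_integral (F b - F a)) {a..b}"
  proof (rule fundamental_theorem_of_calculus_interior[OF assms(2)])
    show "continuous_on {a..b} F" unfolding F_def
      using assms by (intro continuous_on_minus continuous_on_divide continuous_on_powr'
          continuous_on_diff continuous_on_const continuous_on_id) auto
    fix x assume x: "x \<in> {a<..<b}"
    then have pos: "t - x > 0" using assms(3) by simp
    have "((\<lambda>y. t - y) has_real_derivative - 1) (at x)"
      by (auto intro!: derivative_eq_intros)
    from DERIV_fun_powr[OF this pos, of "1 - \<alpha>"]
    have "(F has_real_derivative - ((1 - \<alpha>) * (t - x) powr - \<alpha> * - 1 / (1 - \<alpha>))) (at x)"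
      unfolding F_def by (intro DERIV_minus DERIV_cdivide) simp
    then have "(F has_real_derivative 1 / (t - x) powr \<alpha>) (at x)"
      using assms(1) by (simp add: powr_minus divide_simps)
    then show "(F has_vector_derivative 1 / (t - x) powr \<alpha>) (at x)"
      by (simp add: has_real_derivative_iff_has_vector_derivative)
  qed
  moreover have "F b - F a = ((t - a) powr (1 - \<alpha>) - (t - b) powr (1 - \<alpha>)) / (1 - \<alpha>)"
    by (simp add: F_def diff_divide_distrib)
  ultimately show ?thesis by simp
qed

text \<open>After division by \<open>(t - m)\<^bsup>-\<alpha>\<^esup>\<close> the difference is the error of the expansion of
  \<open>(1 - \<sigma>)\<^bsup>-\<alpha>\<^esup>\<close> at \<open>\<sigma> = (\<tau> - m) / (t - m)\<close>. The bound is expressed through the kernel at \<open>\<tau>\<close>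
  instead of \<open>m\<close>, at the cost of the factor \<open>(4/3)\<^bsup>\<alpha>\<^esup>\<close>, so that the errors on different
  subintervals are bounded by integrals of one and the same function.\<close>

lemma local_expansion_error:
  fixes \<alpha> :: real and t a b :: real
  assumes "0 \<le> \<alpha>" "a < b" "b - a \<le> t - b" "\<tau> \<in> {a..b}"
    and kernel: "\<forall>\<sigma>\<in>{-1/3..1/3}. \<bar>1 / (1 - \<sigma>) powr \<alpha> - (\<Sum>k\<le>K. w k * \<sigma> ^ k)\<bar> \<le> \<epsilon>"
  defines "m \<equiv> (a + b) / 2"
  shows "\<bar>1 / (t - \<tau>) powr \<alpha> - (\<Sum>k\<le>K. faom_weight w \<alpha> t a b k * ((\<tau> - m) / (b - m)) ^ k)\<bar>
    \<le> (4 / 3) powr \<alpha> * \<epsilon> * (1 / (t - \<tau>) powr \<alpha>)"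
proof -
  define \<sigma> where "\<sigma> = (\<tau> - m) / (t - m)"
  have tm: "t - m > 0" and bm: "b - m > 0" using assms by (auto simp: m_def)
  have \<sigma>: "\<sigma> \<in> {-1/3..1/3}"
    using assms(2-4) tm by (auto simp: \<sigma>_def m_def field_simps)
  have t\<tau>: "t - \<tau> = (t - m) * (1 - \<sigma>)"
    using tm by (simp add: \<sigma>_def field_simps)
  have s1: "1 / (t - \<tau>) powr \<alpha> = 1 / (t - m) powr \<alpha> * (1 / (1 - \<sigma>) powr \<alpha>)"
    using tm \<sigma> by (simp add: t\<tau> powr_mult)
  have "faom_weight w \<alpha> t a b k * ((\<tau> - m) / (b - m)) ^ k
      = 1 / (t - m) powr \<alpha> * (w k * \<sigma> ^ k)" for k
    using tm bm unfolding faom_weight_def m_def[symmetric]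
    by (simp add: powr_add powr_realpow \<sigma>_def power_divide divide_simps)
  then have "1 / (t - \<tau>) powr \<alpha> - (\<Sum>k\<le>K. faom_weight w \<alpha> t a b k * ((\<tau> - m) / (b - m)) ^ k)
      = 1 / (t - m) powr \<alpha> * (1 / (1 - \<sigma>) powr \<alpha> - (\<Sum>k\<le>K. w k * \<sigma> ^ k))"
    by (simp add: s1 sum_distrib_left right_diff_distrib)
  then have "\<bar>1 / (t - \<tau>) powr \<alpha> - (\<Sum>k\<le>K. faom_weight w \<alpha> t a b k * ((\<tau> - m) / (b - m)) ^ k)\<bar>
      = 1 / (t - m) powr \<alpha> * \<bar>1 / (1 - \<sigma>) powr \<alpha> - (\<Sum>k\<le>K. w k * \<sigma> ^ k)\<bar>"
    by (simp add: abs_mult)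
  also have "\<dots> \<le> 1 / (t - m) powr \<alpha> * \<epsilon>"
    using kernel \<sigma> by (intro mult_left_mono) auto
  also have "\<dots> \<le> ((4 / 3) powr \<alpha> / (t - \<tau>) powr \<alpha>) * \<epsilon>"
  proof (rule mult_right_mono)
    have "(t - \<tau>) powr \<alpha> \<le> (4 / 3 * (t - m)) powr \<alpha>"
      using tm \<sigma> assms(1) mult_left_mono[of "1 - \<sigma>" "4/3" "t - m"]
      by (intro powr_mono2) (auto simp: t\<tau> mult.commute)
    then have "(t - \<tau>) powr \<alpha> \<le> (4 / 3) powr \<alpha> * (t - m) powr \<alpha>"
      using tm by (simp only: powr_mult)
    moreover have "(t - \<tau>) powr \<alpha> > 0" "(t - m) powr \<alpha> > 0"
      using tm \<sigma> by (auto simp: t\<tau>)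
    ultimately show "1 / (t - m) powr \<alpha> \<le> (4 / 3) powr \<alpha> / (t - \<tau>) powr \<alpha>"
      by (simp add: divide_simps)
    show "0 \<le> \<epsilon>" using kernel[rule_format, OF \<sigma>] by linarith
  qed
  finally show ?thesis by simp
qed

section \<open>The error of the local quadratures\<close>

lemma integrable_bounded_times_kernel:
  fixes p f :: "real \<Rightarrow> real"
  assumes "p \<in> borel_measurable borel" "\<And>x. x \<in> {a..b} \<Longrightarrow> \<bar>p x\<bar> \<le> G"
    and "f absolutely_integrable_on {a..b}"
  shows "(\<lambda>x. p x * f x) integrable_on {a..b}"
proof -
  have "(\<lambda>x. p x * f x) absolutely_integrable_on {a..b}"
  proof (rule absolutely_integrable_bounded_measurable_product_real)
    show "p \<in> borel_measurable (lebesgue_on {a..b})"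
      using assms(1) by (intro measurable_restrict_space1 measurable_completion) simp
    show "bounded (p ` {a..b})"
      unfolding bounded_iff using assms(2) by (auto intro!: exI[of _ G])
  qed (use assms(3) in auto)
  then show ?thesis using absolutely_integrable_on_def by blast
qed

lemma integrable_bounded_times_singular_kernel:
  fixes p :: "real \<Rightarrow> real"
  assumes "p \<in> borel_measurable borel" "\<And>x. x \<in> {a..b} \<Longrightarrow> \<bar>p x\<bar> \<le> G"
    and "\<alpha> < 1" "b \<le> t"
  shows "(\<lambda>x. p x / (t - x) powr \<alpha>) integrable_on {a..b}"
proof (cases "a \<le> b")
  case True
  have "(\<lambda>x. 1 / (t - x) powr \<alpha>) absolutely_integrable_on {a..b}"
    using kernel_has_integral[OF assms(3) True assms(4)]
    by (intro nonnegative_absolutely_integrable_1) auto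
  from integrable_bounded_times_kernel[OF assms(1,2) this] show ?thesis by simp
qed (simp add: integrable_on_empty)

lemma subinterval_quadrature_error:
  fixes \<alpha> :: real and p :: "real \<Rightarrow> real"
  assumes "0 \<le> \<alpha>" "\<alpha> < 1" "a < b" "b - a \<le> t - b"
    and kernel: "\<forall>\<sigma>\<in>{-1/3..1/3}. \<bar>1 / (1 - \<sigma>) powr \<alpha> - (\<Sum>k\<le>K. w k * \<sigma> ^ k)\<bar> \<le> \<epsilon>"
    and p: "p \<in> borel_measurable borel" "\<And>x. x \<in> {a..b} \<Longrightarrow> \<bar>p x\<bar> \<le> G"
  defines "m \<equiv> (a + b) / 2"
  shows "\<bar>integral {a..b} (\<lambda>x. p x / (t - x) powr \<alpha>) -
      (\<Sum>k\<le>K. faom_weight w \<alpha> t a b k * integral {a..b} (\<lambda>x. p x * ((x - m) / (b - m)) ^ k))\<bar>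
    \<le> G * ((4 / 3) powr \<alpha> * \<epsilon>) * (((t - a) powr (1 - \<alpha>) - (t - b) powr (1 - \<alpha>)) / (1 - \<alpha>))"
proof -
  let ?q = "\<lambda>x. \<Sum>k\<le>K. faom_weight w \<alpha> t a b k * ((x - m) / (b - m)) ^ k"
  have int1: "(\<lambda>x. p x / (t - x) powr \<alpha>) integrable_on {a..b}"
    using assms by (intro integrable_bounded_times_singular_kernel[OF p]) auto
  have int2: "(\<lambda>x. p x * ((x - m) / (b - m)) ^ k) integrable_on {a..b}" for k
    using assms(3) by (intro integrable_bounded_times_kernel[OF p]
        absolutely_integrable_continuous_real continuous_intros) (auto simp: m_def)
  have expand: "p x * ?q x = (\<Sum>k\<le>K. faom_weight w \<alpha> t a b k * (p x * ((x - m) / (b - m)) ^ k))" for x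
    by (simp add: sum_distrib_left mult_ac)
  have int3: "(\<lambda>x. p x * ?q x) integrable_on {a..b}"
    unfolding expand by (intro integrable_sum integrable_on_mult_right int2) auto
  have K: "((\<lambda>x. 1 / (t - x) powr \<alpha>) has_integral
      ((t - a) powr (1 - \<alpha>) - (t - b) powr (1 - \<alpha>)) / (1 - \<alpha>)) {a..b}"
    using assms by (intro kernel_has_integral) auto
  have "integral {a..b} (\<lambda>x. p x * ?q x) =
      (\<Sum>k\<le>K. faom_weight w \<alpha> t a b k * integral {a..b} (\<lambda>x. p x * ((x - m) / (b - m)) ^ k))"
    unfolding expand by (simp add: integral_sum integrable_on_mult_right int2)
  then have eq: "integral {a..b} (\<lambda>x. p x / (t - x) powr \<alpha>) -
      (\<Sum>k\<le>K. faom_weight w \<alpha> t a b k * integral {a..b} (\<lambda>x. p x * ((x - m) / (b - m)) ^ k))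
    = integral {a..b} (\<lambda>x. p x / (t - x) powr \<alpha> - p x * ?q x)"
    using Henstock_Kurzweil_Integration.integral_diff[OF int1 int3] by simp
  have bound: "\<bar>integral {a..b} (\<lambda>x. p x / (t - x) powr \<alpha> - p x * ?q x)\<bar>
    \<le> integral {a..b} (\<lambda>x. G * ((4 / 3) powr \<alpha> * \<epsilon>) * (1 / (t - x) powr \<alpha>))"
    unfolding real_norm_def[symmetric]
  proof (rule integral_norm_bound_integral)
    show "(\<lambda>x. p x / (t - x) powr \<alpha> - p x * ?q x) integrable_on {a..b}"
      by (intro integrable_diff int1 int3)
    show "(\<lambda>x. G * ((4 / 3) powr \<alpha> * \<epsilon>) * (1 / (t - x) powr \<alpha>)) integrable_on {a..b}"
      using K by (intro integrable_on_mult_right) blast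
    fix x assume x: "x \<in> {a..b}"
    have "p x / (t - x) powr \<alpha> - p x * ?q x = p x * (1 / (t - x) powr \<alpha> - ?q x)"
      by (simp add: right_diff_distrib)
    then have "norm (p x / (t - x) powr \<alpha> - p x * ?q x)
        = \<bar>p x\<bar> * \<bar>1 / (t - x) powr \<alpha> - ?q x\<bar>"
      by (simp only: real_norm_def abs_mult)
    also have "\<dots> \<le> G * ((4 / 3) powr \<alpha> * \<epsilon> * (1 / (t - x) powr \<alpha>))"
      using local_expansion_error[OF assms(1,3,4) x kernel] p(2)[OF x]
      unfolding m_def by (intro mult_mono) auto
    finally show "norm (p x / (t - x) powr \<alpha> - p x * ?q x)
      \<le> G * ((4 / 3) powr \<alpha> * \<epsilon>) * (1 / (t - x) powr \<alpha>)" by (simp add: mult.assoc)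
  qed
  show ?thesis
    unfolding eq using bound integral_unique[OF has_integral_mult_right[OF K]] by metis
qed

text \<open>Both the exact integral and the bounds of the single errors telescope over the
  subintervals, so the bound depends neither on their number nor on their lengths.\<close>

lemma composite_quadrature_error:
  fixes \<alpha> :: real and p :: "real \<Rightarrow> real" and s :: real
  assumes "0 \<le> \<alpha>" "\<alpha> < 1" and L: "admissible t (s # I)" and s: "s < t" and G: "0 \<le> G"
    and \<epsilon>: "0 \<le> \<epsilon>"
    and kernel: "\<forall>\<sigma>\<in>{-1/3..1/3}. \<bar>1 / (1 - \<sigma>) powr \<alpha> - (\<Sum>k\<le>K. w k * \<sigma> ^ k)\<bar> \<le> \<epsilon>"
    and p: "p \<in> borel_measurable borel" "\<And>x. x \<in> {0..t} \<Longrightarrow> \<bar>p x\<bar> \<le> G"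
  defines "P \<equiv> s # I"
  shows "\<bar>integral {0..s} (\<lambda>x. p x / (t - x) powr \<alpha>) -
      (\<Sum>i<length I. \<Sum>k\<le>K. faom_weight w \<alpha> t (P ! Suc i) (P ! i) k *
        integral {P ! Suc i..P ! i} (\<lambda>x. p x *
          ((x - (P ! Suc i + P ! i) / 2) / (P ! i - (P ! Suc i + P ! i) / 2)) ^ k))\<bar>
    \<le> G * ((4 / 3) powr \<alpha> * \<epsilon>) * (t powr (1 - \<alpha>) / (1 - \<alpha>))"
    (is "\<bar>_ - (\<Sum>i<_. ?Q i)\<bar> \<le> ?c * _")
proof -
  let ?f = "\<lambda>x. p x / (t - x) powr \<alpha>"
  let ?\<Phi> = "\<lambda>x. integral {0..x} ?f"
  let ?\<Psi> = "\<lambda>x. (t - x) powr (1 - \<alpha>) / (1 - \<alpha>)"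
  have "last P = 0" using L unfolding admissible_def P_def by blast
  then have last: "P ! length I = 0" by (simp add: P_def last_conv_nth del: last.simps)
  have piece: "\<bar>(?\<Phi> (P ! i) - ?\<Phi> (P ! Suc i)) - ?Q i\<bar> \<le> ?c * (?\<Psi> (P ! Suc i) - ?\<Psi> (P ! i))"
    if i: "i < length I" for i
  proof -
    have ab: "P ! Suc i < P ! i" "P ! i - P ! Suc i \<le> t - P ! i"
      using L i unfolding admissible_def P_def by auto
    have b: "0 \<le> P ! Suc i" "P ! i \<le> s"
      using admissible_nth_bounds[OF L, of "Suc i"] admissible_nth_bounds[OF L, of i] i
      unfolding P_def by auto
    have "?f integrable_on {0..P ! i}"
      using b s assms(2) by (intro integrable_bounded_times_singular_kernel[OF p(1), of _ _ G] p(2)) auto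
    from Henstock_Kurzweil_Integration.integral_combine[OF b(1) less_imp_le[OF ab(1)] this]
    have "?\<Phi> (P ! i) - ?\<Phi> (P ! Suc i) = integral {P ! Suc i..P ! i} ?f" by simp
    moreover have "\<bar>p x\<bar> \<le> G" if "x \<in> {P ! Suc i..P ! i}" for x
      using that b s by (intro p(2)) auto
    ultimately show ?thesis
      using subinterval_quadrature_error[OF assms(1,2) ab kernel p(1), of G]
      by (simp add: diff_divide_distrib)
  qed
  have "integral {0..s} ?f = (\<Sum>i<length I. ?\<Phi> (P ! i) - ?\<Phi> (P ! Suc i))"
    using sum_lessThan_telescope'[of "\<lambda>i. ?\<Phi> (P ! i)" "length I"] last by (simp add: P_def)
  then have "\<bar>integral {0..s} ?f - (\<Sum>i<length I. ?Q i)\<bar>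
      = \<bar>\<Sum>i<length I. (?\<Phi> (P ! i) - ?\<Phi> (P ! Suc i)) - ?Q i\<bar>"
    by (simp only: sum_subtractf)
  also have "\<dots> \<le> (\<Sum>i<length I. ?c * (?\<Psi> (P ! Suc i) - ?\<Psi> (P ! i)))"
    by (rule order.trans[OF sum_abs], rule sum_mono, rule piece) auto
  also have "\<dots> = ?c * (?\<Psi> 0 - ?\<Psi> s)"
    using sum_lessThan_telescope[of "\<lambda>i. ?\<Psi> (P ! i)" "length I"] last
    unfolding sum_distrib_left[symmetric] by (simp add: P_def)
  also have "\<dots> \<le> ?c * (t powr (1 - \<alpha>) / (1 - \<alpha>))"
    using G \<epsilon> assms(2) by (intro mult_left_mono) auto
  finally show ?thesis .
qed

section \<open>The derivative of the interpolant\<close>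

lemma cell_eq:
  assumes "h > 0" "j \<ge> 1" "grid h (j - 1) < x" "x < grid h j"
  shows "cell h x = j"
proof -
  have "\<lceil>x / h\<rceil> = int j"
    using assms by (intro ceiling_unique) (auto simp: grid_def of_nat_diff field_simps)
  then show ?thesis using assms(2) by (simp add: cell_def)
qed

lemma grid_cell_bounds:
  assumes "h > 0" "0 \<le> x"
  shows "cell h x \<ge> 1" "grid h (cell h x - 1) \<le> x" "x \<le> grid h (cell h x)"
proof -
  define c where "c = nat \<lceil>x / h\<rceil>"
  have "x / h \<le> real c" unfolding c_def by (rule real_nat_ceiling_ge)
  also have "\<dots> \<le> real (max 1 c)" by simp
  finally show "x \<le> grid h (cell h x)"
    using assms(1) by (simp add: cell_def grid_def c_def field_simps)
  have "real (c - 1) \<le> x / h"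
  proof (cases "c \<ge> 1")
    case True
    then have "real (c - 1) = of_int \<lceil>x / h\<rceil> - 1" by (simp add: c_def of_nat_diff)
    then show ?thesis by linarith
  next
    case False
    then have "c - 1 = 0" by linarith
    then show ?thesis using assms by (metis divide_nonneg_pos of_nat_0)
  qed
  moreover have "cell h x - 1 = c - 1" by (simp add: cell_def c_def)
  ultimately show "grid h (cell h x - 1) \<le> x"
    using assms(1) by (simp add: grid_def field_simps)
  show "cell h x \<ge> 1" by (simp add: cell_def)
qed

lemma cell_le:
  assumes "h > 0" "n \<ge> 1" "x \<le> grid h n"
  shows "cell h x \<le> n"
proof -
  have "x / h \<le> real n" using assms by (simp add: grid_def field_simps)
  then have "\<lceil>x / h\<rceil> \<le> int n" by (intro ceiling_le) simp
  then have "nat \<lceil>x / h\<rceil> \<le> n" by linarith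
  then show ?thesis using assms(2) unfolding cell_def by (intro max.boundedI)
qed

lemma measurable_cell: "cell h \<in> measurable borel (count_space UNIV)"
  unfolding cell_def by measurable

lemma lagrange_2:
  assumes "a \<noteq> b"
  shows "lagrange {a, b} u x = u a + (u b - u a) / (b - a) * (x - a)"
proof -
  have "{a, b} - {a} = {b}" "{a, b} - {b} = {a}" using assms by auto
  then have "lagrange {a, b} u x = u a * ((x - b) / (a - b)) + u b * ((x - a) / (b - a))"
    using assms by (simp add: lagrange_def)
  also have "\<dots> = u a + (u b - u a) / (b - a) * (x - a)"
    using assms by (simp add: divide_simps) (simp add: algebra_simps)
  finally show ?thesis .
qed

text \<open>In Newton form the derivative shows the slopes of the chords, which are what the derivative
  of \<open>u\<close> controls.\<close>

lemma lagrange_3: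
  assumes "a \<noteq> b" "b \<noteq> c" "a \<noteq> c"
  shows "lagrange {a, b, c} u x = u a + (u b - u a) / (b - a) * (x - a) +
    ((u c - u b) / (c - b) - (u b - u a) / (b - a)) / (c - a) * ((x - a) * (x - b))"
proof -
  have "{a, b, c} - {a} = {b, c}" "{a, b, c} - {b} = {a, c}" "{a, b, c} - {c} = {a, b}"
    using assms by auto
  then have "lagrange {a, b, c} u x = u a * ((x - b) / (a - b) * ((x - c) / (a - c)))
     + u b * ((x - a) / (b - a) * ((x - c) / (b - c)))
     + u c * ((x - a) / (c - a) * ((x - b) / (c - b)))"
    using assms by (simp add: lagrange_def)
  also have "\<dots> = u a + (u b - u a) / (b - a) * (x - a) +
    ((u c - u b) / (c - b) - (u b - u a) / (b - a)) / (c - a) * ((x - a) * (x - b))"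
    using assms by (simp add: divide_simps) (simp add: algebra_simps)
  finally show ?thesis .
qed

definition slope :: "real \<Rightarrow> (real \<Rightarrow> real) \<Rightarrow> nat \<Rightarrow> real" where
  "slope h u j = (u (grid h j) - u (grid h (j - 1))) / h"

text \<open>The derivative of the interpolant on the cell with number \<open>j\<close>. In the quadratic case it is
  the linear function that takes the values \<open>slope h u (j - 1)\<close> and \<open>slope h u j\<close> at the
  midpoints of the cells \<open>j - 1\<close> and \<open>j\<close>. Unlike the derivative itself, it is defined at the
  grid points too.\<close>

definition interp_slope :: "nat \<Rightarrow> real \<Rightarrow> (real \<Rightarrow> real) \<Rightarrow> nat \<Rightarrow> real \<Rightarrow> real" where
  "interp_slope J h u j x =
    (if J = 1 \<or> j < 2 then slope h u j
     else slope h u j + (slope h u j - slope h u (j - 1)) * ((x - grid h (j - 1)) / h - 1/2))"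

lemma deriv_interp:
  assumes h: "h > 0" and j: "j \<ge> 1" and x: "grid h (j - 1) < x" "x < grid h j"
  shows "deriv (interp J h u) x = interp_slope J h u j x"
proof (rule DERIV_imp_deriv)
  have cell: "cell h y = j" if "y \<in> {grid h (j - 1)<..<grid h j}" for y
    using that cell_eq[OF h j] by auto
  define a where "a = grid h (j - 1)"
  have a: "grid h (j - Suc 0) = a" "\<not> 2 \<le> j \<Longrightarrow> grid h 0 = a"
    using j by (auto simp: a_def le_Suc_eq not_le less_Suc_eq numeral_2_eq_2)
  have c: "grid h j = a + h" using j by (simp add: a_def grid_def of_nat_diff algebra_simps)
  have "(interp J h u has_real_derivative interp_slope J h u j x) (at x)"
  proof (cases "J = 1 \<or> j < 2")
    case True
    have "((\<lambda>y. u a + slope h u j * (y - a)) has_real_derivative interp_slope J h u j x) (at x)"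
      using True by (auto intro!: derivative_eq_intros simp: interp_slope_def)
    then show ?thesis
    proof (rule has_field_derivative_transform_within_open)
      show "open {grid h (j - 1)<..<grid h j}" by simp
      fix y assume y: "y \<in> {grid h (j - 1)<..<grid h j}"
      show "u a + slope h u j * (y - a) = interp J h u y"
        using True h lagrange_2[of a "a + h" u y]
        by (auto simp: interp_def interp1_def interp2_def cell[OF y] c slope_def a)
    qed (use x in auto)
  next
    case False
    then have b: "grid h (j - 2) = a - h"
      by (simp add: a_def grid_def of_nat_diff algebra_simps)
    then have b': "grid h (j - Suc (Suc 0)) = a - h" by (simp add: numeral_2_eq_2)
    let ?q = "\<lambda>y. u (a - h) + slope h u (j - 1) * (y - (a - h)) +
      (slope h u j - slope h u (j - 1)) / (2 * h) * ((y - (a - h)) * (y - a))"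
    have "(?q has_real_derivative interp_slope J h u j x) (at x)"
      using False h by (auto intro!: derivative_eq_intros simp: interp_slope_def a(1))
        (simp add: field_simps)
    then show ?thesis
    proof (rule has_field_derivative_transform_within_open)
      show "open {grid h (j - 1)<..<grid h j}" by simp
      fix y assume y: "y \<in> {grid h (j - 1)<..<grid h j}"
      show "?q y = interp J h u y"
        using False h lagrange_3[of "a - h" a "a + h" u y]
        by (auto simp: interp_def interp2_def cell[OF y] b b' c slope_def a(1))
    qed (use x in auto)
  qed
  then show "(interp J h u has_field_derivative interp_slope J h u j x) (at x)" .
qed

text \<open>The cell number is a measurable function with countably many values, and on each cell the
  slope is a polynomial.\<close>

lemma interp_slope_measurable:
  "(\<lambda>x. interp_slope J h u (cell h x) x) \<in> borel_measurable borel"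
proof (rule measurable_compose_countable[OF _ measurable_cell])
  fix j
  show "interp_slope J h u j \<in> borel_measurable borel"
    unfolding interp_slope_def by measurable
qed

text \<open>On cell \<open>j\<close> the derivative of the quadratic interpolant is
  \<open>(1 + \<theta>) s\<^sub>j - \<theta> s\<^sub>j\<^sub>-\<^sub>1\<close> with \<open>\<bar>\<theta>\<bar> \<le> 1/2\<close>, where \<open>s\<^sub>j\<close> is the slope of the chord on cell \<open>j\<close>: an
  extrapolation with the constant \<open>3/2 + 1/2 = 2\<close>.\<close>

lemma interp_slope_bound:
  assumes h: "h > 0" and n: "n \<ge> 1" and x: "x \<in> {0..grid h n}"
    and s: "\<And>j. 1 \<le> j \<Longrightarrow> j \<le> n \<Longrightarrow> \<bar>slope h u j\<bar> \<le> M"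
  shows "\<bar>interp_slope J h u (cell h x) x\<bar> \<le> 2 * M"
proof -
  define j where "j = cell h x"
  have j: "1 \<le> j" "j \<le> n" "grid h (j - 1) \<le> x" "x \<le> grid h j"
    using grid_cell_bounds[OF h] cell_le[OF h n] x unfolding j_def by auto
  have sj: "\<bar>slope h u j\<bar> \<le> M" using s j by blast
  show ?thesis
  proof (cases "J = 1 \<or> j < 2")
    case True
    then show ?thesis using sj unfolding j_def[symmetric] interp_slope_def by auto
  next
    case False
    then have sj': "\<bar>slope h u (j - 1)\<bar> \<le> M" using s[of "j - 1"] j by auto
    define \<theta> where "\<theta> = (x - grid h (j - 1)) / h - 1/2"
    have \<theta>: "\<bar>\<theta>\<bar> \<le> 1/2" "\<bar>1 + \<theta>\<bar> \<le> 3/2"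
      using j h by (auto simp: \<theta>_def grid_def of_nat_diff field_simps abs_le_iff)
    have "interp_slope J h u j x = slope h u j * (1 + \<theta>) - slope h u (j - 1) * \<theta>"
      using False unfolding interp_slope_def \<theta>_def[symmetric] by (simp add: algebra_simps)
    also have "\<bar>\<dots>\<bar> \<le> \<bar>slope h u j\<bar> * \<bar>1 + \<theta>\<bar> + \<bar>slope h u (j - 1)\<bar> * \<bar>\<theta>\<bar>"
      by (metis abs_mult abs_triangle_ineq4)
    also have "\<dots> \<le> M * (3/2) + M * (1/2)"
      using sj sj' \<theta> by (intro add_mono mult_mono) auto
    finally show ?thesis by (simp add: j_def)
  qed
qed

lemma deriv_interp_off_grid:
  assumes h: "h > 0" and n: "n \<ge> 1" and x: "x \<in> {0..grid h n} - grid h ` {0..n}"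
  shows "deriv (interp J h u) x = interp_slope J h u (cell h x) x"
proof -
  have "x \<noteq> grid h j" if "j \<le> n" for j using x that by auto
  then have "cell h x \<le> n \<Longrightarrow> x \<noteq> grid h (cell h x)" "cell h x \<le> n \<Longrightarrow> x \<noteq> grid h (cell h x - 1)"
    by auto
  moreover have "1 \<le> cell h x" "cell h x \<le> n" "grid h (cell h x - 1) \<le> x" "x \<le> grid h (cell h x)"
    using grid_cell_bounds[OF h] cell_le[OF h n] x by auto
  ultimately show ?thesis
    by (intro deriv_interp[OF h]) auto
qed

text \<open>The mean value inequality for one-sided derivatives. Continuity of the derivative on the
  compact interval makes the supremum a genuine upper bound.\<close>

lemma Ck_on_increment_bound:
  fixes u :: "real \<Rightarrow> real"
  assumes "Ck_on (Suc m) u {a..b}" "a < b"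
  defines "M \<equiv> (SUP t\<in>{a..b}. \<bar>vector_derivative u (at t within {a..b})\<bar>)"
  shows "\<And>x y. x \<in> {a..b} \<Longrightarrow> y \<in> {a..b} \<Longrightarrow> \<bar>u y - u x\<bar> \<le> M * \<bar>y - x\<bar>" and "0 \<le> M"
proof -
  obtain D where D0: "\<And>t. t \<in> {a..b} \<Longrightarrow> D 0 t = u t"
    and D: "\<And>k t. k < Suc m \<Longrightarrow> t \<in> {a..b} \<Longrightarrow>
      (D k has_real_derivative D (Suc k) t) (at t within {a..b})"
    and Dm: "continuous_on {a..b} (D (Suc m))"
    using assms(1) unfolding Ck_on_def by blast
  have du: "(u has_real_derivative D 1 t) (at t within {a..b})" if "t \<in> {a..b}" for t
    using D[of 0 t] that D0 by (auto intro: has_field_derivative_transform_within[of _ _ _ _ 1])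
  have vd: "vector_derivative u (at t within {a..b}) = D 1 t" if "t \<in> {a..b}" for t
    using du[OF that] that assms(2)
      vector_derivative_within_cbox[of a b t u "D 1 t"]
    by (simp add: has_real_derivative_iff_has_vector_derivative)
  have "continuous_on {a..b} (D 1)"
  proof (cases m)
    case 0
    then show ?thesis using Dm by simp
  next
    case (Suc k)
    then show ?thesis using D[of 1] by (intro DERIV_continuous_on) auto
  qed
  then have "compact ((\<lambda>t. \<bar>D 1 t\<bar>) ` {a..b})"
    by (intro compact_continuous_image continuous_intros) auto
  then have bdd: "bdd_above ((\<lambda>t. \<bar>D 1 t\<bar>) ` {a..b})"
    by (intro bounded_imp_bdd_above compact_imp_bounded)
  have M: "M = (SUP t\<in>{a..b}. \<bar>D 1 t\<bar>)" unfolding M_def using vd by (intro SUP_cong) auto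
  have DM: "\<bar>D 1 t\<bar> \<le> M" if "t \<in> {a..b}" for t
    unfolding M by (rule cSUP_upper[OF that bdd])
  show "\<bar>u y - u x\<bar> \<le> M * \<bar>y - x\<bar>" if "x \<in> {a..b}" "y \<in> {a..b}" for x y
    using field_differentiable_bound[OF convex_closed_interval(1)[of a b] du, of M y x] DM that
    by (auto simp: norm_minus_commute abs_minus_commute)
  show "0 \<le> M" using DM[of a] assms(2) by auto
qed

lemma slope_bound:
  assumes h: "h > 0" and n: "n \<ge> 1" and u: "Ck_on (Suc m) u {0..grid h n}"
    and j: "1 \<le> j" "j \<le> n"
  shows "\<bar>slope h u j\<bar>
    \<le> (SUP t\<in>{0..grid h n}. \<bar>vector_derivative u (at t within {0..grid h n})\<bar>)"
proof -
  have pos: "0 < grid h n" using h n by (simp add: grid_def)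
  have mem: "grid h (j - 1) \<in> {0..grid h n}" "grid h j \<in> {0..grid h n}"
    using h j by (auto simp: grid_def)
  have "grid h j - grid h (j - 1) = h" using j by (simp add: grid_def of_nat_diff algebra_simps)
  with Ck_on_increment_bound(1)[OF u pos mem] h
  show ?thesis by (simp add: slope_def abs_divide divide_le_eq)
qed

section \<open>The gap to the Caputo derivative\<close>

theorem theorem2p1:
  fixes \<alpha> :: real and J N\<^sub>\<tau> K :: nat
  assumes "0 < \<alpha>" and "\<alpha> < 1" and "J \<in> {1, 2}" and "2 \<le> N\<^sub>\<tau>"
  shows "\<exists>C :: real.
    \<forall>(T :: real) (N\<^sub>T :: nat) (h :: real) (w :: nat \<Rightarrow> real) (\<epsilon> :: real)
      (n :: nat) (I :: real list) (u :: real \<Rightarrow> real).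
      0 < T \<longrightarrow> h = T / real N\<^sub>T \<longrightarrow> 2 \<le> n \<longrightarrow> n \<le> N\<^sub>T \<longrightarrow>
      0 \<le> \<epsilon> \<longrightarrow>
      (\<forall>\<tau>\<in>{-1/3..1/3}. \<bar>1 / (1 - \<tau>) powr \<alpha> - (\<Sum>k\<le>K. w k * \<tau> ^ k)\<bar> \<le> \<epsilon>) \<longrightarrow>
      subdivision h N\<^sub>\<tau> n I \<longrightarrow>
      Ck_on (J + 1) u {0..grid h n} \<longrightarrow>
      \<bar>caputo \<alpha> u (grid h n) - caputo_faom J h K w I \<alpha> u n\<bar>
        \<le> \<bar>trunc_error J h \<alpha> u n\<bar>
          + C * \<epsilon> * grid h n powr (1 - \<alpha>)
            * (SUP t\<in>{0..grid h n}. \<bar>vector_derivative u (at t within {0..grid h n})\<bar>)"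
proof -
  define \<Gamma> where "\<Gamma> = Gamma (1 - \<alpha>)"
  have \<Gamma>: "\<Gamma> > 0" using assms(2) by (simp add: \<Gamma>_def Gamma_real_pos)
  show ?thesis
  proof (intro exI[of _ "2 * (4 / 3) powr \<alpha> / ((1 - \<alpha>) * \<Gamma>)"] allI impI)
    fix T h \<epsilon> :: real and N\<^sub>T n :: nat and w :: "nat \<Rightarrow> real" and I :: "real list"
      and u :: "real \<Rightarrow> real"
    assume T: "0 < T" "h = T / real N\<^sub>T" and n: "2 \<le> n" "n \<le> N\<^sub>T" and \<epsilon>: "0 \<le> \<epsilon>"
      and kernel: "\<forall>\<tau>\<in>{-1/3..1/3}. \<bar>1 / (1 - \<tau>) powr \<alpha> - (\<Sum>k\<le>K. w k * \<tau> ^ k)\<bar> \<le> \<epsilon>"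
      and I: "subdivision h N\<^sub>\<tau> n I" and u: "Ck_on (J + 1) u {0..grid h n}"
    define t where "t = grid h n"
    define s where "s = grid h (n - 1)"
    define P where "P = s # I"
    define M where "M = (SUP t\<in>{0..grid h n}. \<bar>vector_derivative u (at t within {0..grid h n})\<bar>)"
    define g where "g = deriv (interp J h u)"
    define p where "p = (\<lambda>x. interp_slope J h u (cell h x) x)"
    have h: "h > 0" using T n by simp
    have st: "0 \<le> s" "s < t" "0 < t"
      using h n by (auto simp: s_def t_def grid_def)
    have M: "M \<ge> 0"
      using Ck_on_increment_bound(2)[of J u 0 "grid h n"] u st by (simp add: M_def t_def)
    have p_meas: "p \<in> borel_measurable borel"
      unfolding p_def by (rule interp_slope_measurable)
    have p_bound: "\<bar>p x\<bar> \<le> 2 * M" if "x \<in> {0..t}" for x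
      unfolding p_def M_def
    proof (rule interp_slope_bound[OF h])
      show "1 \<le> n" using n by simp
      show "x \<in> {0..grid h n}" using that by (simp add: t_def)
      show "\<bar>slope h u j\<bar> \<le> (SUP t\<in>{0..grid h n}. \<bar>vector_derivative u (at t within {0..grid h n})\<bar>)"
        if "1 \<le> j" "j \<le> n" for j
        using slope_bound[OF h _ _ that, of J] u n by simp
    qed
    \<comment> \<open>The grid points form a null set, so the unspecified values of \<open>g\<close> there do not affect
      any of the integrals, and \<open>p\<close> can replace \<open>g\<close>.\<close>
    have gp: "g x = p x" if "x \<in> {0..t} - grid h ` {0..n}" for x
      unfolding g_def p_def using that n by (intro deriv_interp_off_grid[OF h, of n]) (auto simp: t_def)
    have spike: "integral {a..b} (\<lambda>x. g x * f x) = integral {a..b} (\<lambda>x. p x * f x)"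
      if "{a..b} \<subseteq> {0..t}" for a b and f :: "real \<Rightarrow> real"
      using gp that by (intro integral_spike[of "grid h ` {0..n}"]) auto
    have spike_div: "integral {a..b} (\<lambda>x. g x / f x) = integral {a..b} (\<lambda>x. p x / f x)"
      if "{a..b} \<subseteq> {0..t}" for a b and f :: "real \<Rightarrow> real"
      using spike[OF that, of "\<lambda>x. 1 / f x"] by simp
    have adm: "admissible t (s # I)"
      using subdivision_admissible[OF I h assms(4)] by (simp add: t_def s_def)
    have sub: "{P ! Suc i..P ! i} \<subseteq> {0..t}" if "i < length I" for i
      using admissible_nth_bounds[OF adm, of "Suc i"] admissible_nth_bounds[OF adm, of i] that st
      by (auto simp: P_def)
    define Q where "Q = (\<Sum>i<length I. \<Sum>k\<le>K. faom_weight w \<alpha> t (P ! Suc i) (P ! i) k *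
        integral {P ! Suc i..P ! i} (\<lambda>x. p x *
          ((x - (P ! Suc i + P ! i) / 2) / (P ! i - (P ! Suc i + P ! i) / 2)) ^ k))"
    let ?f = "\<lambda>x. p x / (t - x) powr \<alpha>"
    have Q: "Q / \<Gamma> = (\<Sum>i<length I. \<Sum>k\<le>K. faom_weight w \<alpha> t (P ! Suc i) (P ! i) k / \<Gamma> *
        integral {P ! Suc i..P ! i} (\<lambda>x. g x *
          ((x - (P ! Suc i + P ! i) / 2) / (P ! i - (P ! Suc i + P ! i) / 2)) ^ k))"
      unfolding Q_def sum_divide_distrib by (intro sum.cong refl) (simp add: spike[OF sub])
    have faom: "caputo_faom J h K w I \<alpha> u n = integral {s..t} ?f / \<Gamma> + Q / \<Gamma>"
      unfolding caputo_faom_def Let_def t_def[symmetric] s_def[symmetric] P_def[symmetric]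
        g_def[symmetric] \<Gamma>_def[symmetric] Q
      using spike_div[of s t "\<lambda>x. (t - x) powr \<alpha>"] st by simp
    have trunc: "trunc_error J h \<alpha> u n = caputo \<alpha> u t - integral {0..t} ?f / \<Gamma>"
      unfolding trunc_error_def t_def[symmetric] g_def[symmetric] \<Gamma>_def[symmetric]
      by (simp add: spike_div)
    have "?f integrable_on {0..t}"
      using assms(2) p_bound by (intro integrable_bounded_times_singular_kernel[OF p_meas]) auto
    then have split: "integral {0..t} ?f = integral {0..s} ?f + integral {s..t} ?f"
      using Henstock_Kurzweil_Integration.integral_combine[of 0 s t ?f] st by simp
    have "caputo \<alpha> u t - caputo_faom J h K w I \<alpha> u n
        = trunc_error J h \<alpha> u n + (integral {0..s} ?f - Q) / \<Gamma>"
      by (simp add: faom trunc split add_divide_distrib diff_divide_distrib)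
    then have le: "\<bar>caputo \<alpha> u t - caputo_faom J h K w I \<alpha> u n\<bar>
        \<le> \<bar>trunc_error J h \<alpha> u n\<bar> + \<bar>integral {0..s} ?f - Q\<bar> / \<Gamma>"
      using abs_triangle_ineq[of "trunc_error J h \<alpha> u n" "(integral {0..s} ?f - Q) / \<Gamma>"] \<Gamma>
      by (simp add: abs_divide)
    have "\<bar>integral {0..s} ?f - Q\<bar> \<le> 2 * M * ((4 / 3) powr \<alpha> * \<epsilon>) * (t powr (1 - \<alpha>) / (1 - \<alpha>))"
      unfolding Q_def P_def
      by (rule composite_quadrature_error[OF _ assms(2) adm st(2) _ \<epsilon> kernel p_meas])
        (use assms(1) M p_bound in auto)
    from divide_right_mono[OF this less_imp_le[OF \<Gamma>]]
    have "\<bar>integral {0..s} ?f - Q\<bar> / \<Gamma>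
        \<le> 2 * (4 / 3) powr \<alpha> / ((1 - \<alpha>) * \<Gamma>) * \<epsilon> * t powr (1 - \<alpha>) * M"
      by (simp add: mult_ac)
    with le show "\<bar>caputo \<alpha> u (grid h n) - caputo_faom J h K w I \<alpha> u n\<bar>
        \<le> \<bar>trunc_error J h \<alpha> u n\<bar> + 2 * (4 / 3) powr \<alpha> / ((1 - \<alpha>) * \<Gamma>) * \<epsilon> *
          grid h n powr (1 - \<alpha>) *
          (SUP t\<in>{0..grid h n}. \<bar>vector_derivative u (at t within {0..grid h n})\<bar>)"
      unfolding M_def t_def by linarith
  qed
qed

end
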